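(* Let $\mathcal X$ be a compact metric space, $\mathcal B$ its Borel $\sigma$-algebra, $\mu$ a Borel probability measure on $\mathcal X$, and $W$ a bounded operator on $\mathcal H=L^2(\mathcal X,\mu)$. For $x\in\mathcal X$ let $\vartheta(x)=\lim_{\varepsilon\searrow0}\|W\pi_{B_\varepsilon(x)}\|^2$, where $B_\varepsilon(x)$ is the open ball of radius $\varepsilon$ centered at $x$ (the limit exists by monotonicity). Suppose that: (C1) the function $\vartheta:\mathcal X\to\mathbb R$ is continuous; (C2) there exist $c>0$ and a function $\gamma$ with $\gamma(\varepsilon)\to0$ as $\varepsilon\to0$ such that for every $\varepsilon>0$, every open $\mathcal O\subset\mathcal X$ with $\operatorname{diam}(\mathcal O)\le\varepsilon$ and every $x\in\mathcal O$ there exists $f\in\mathcal H$ with $f=\pi_{\mathcal O}f$ satisfying $$\Big|\,\|Wf\|^2-\vartheta(x)\|f\|^2\Big|\le\gamma(\varepsilon)\|f\|^2\quad\text{and}\quad c<|f|<c^{-1}\ \text{ on }\mathcal O.$$ Then $\|W\|_\mu^2=\int_{\mathcal X}\vartheta\,d\mu$.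
   Context: For $X\in\mathcal B$, $\pi_X:\mathcal H\to\mathcal H$ is the orthogonal projector $\pi_Xf=\mathbf 1_X f$ on $\mathcal H=L^2(\mathcal X,\mu)$ (complex-valued). A partition is a finite family $\chi=\{Y_1,\dots,Y_J\}\subset\mathcal B$ with $\mu(\mathcal X\setminus\bigcup_j Y_j)=0$ and $\mu(Y_j\cap Y_k)=0$ for $j\ne k$. For a bounded operator $W$ on $\mathcal H$ with operator norm $\|W\|$, put $\mathcal M_\chi(W)=\sum_{j=1}^J\mu(Y_j)\|W\pi_{Y_j}\|^2$, and define the $\mu$-norm $\|W\|_\mu=\inf_\chi\sqrt{\mathcal M_\chi(W)}$, the infimum being over all partitions $\chi$. *)

theory Defs
  imports "HOL-Probability.Probability"
begin

text \<open>
  Elements of the Hilbert space \<open>L\<^sup>2(\<mu>)\<close> are represented by square-integrable measurable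
  functions; equality in \<open>L\<^sup>2(\<mu>)\<close> is equality almost everywhere.
\<close>

definition L2_space :: "'a measure \<Rightarrow> ('a \<Rightarrow> complex) set" where
  "L2_space \<mu> = {f \<in> borel_measurable \<mu>. integrable \<mu> (\<lambda>x. (cmod (f x))\<^sup>2)}"

definition L2_norm :: "'a measure \<Rightarrow> ('a \<Rightarrow> complex) \<Rightarrow> real" where
  "L2_norm \<mu> f = sqrt (\<integral>x. (cmod (f x))\<^sup>2 \<partial>\<mu>)"

text \<open>
  The operator acts on representatives. The second conjunct makes it well defined on classes
  modulo almost-everywhere equality; conversely every bounded operator on the quotient arises
  in this way by choosing representatives of the images.
\<close>

definition L2_bounded_operator ::
    "'a measure \<Rightarrow> (('a \<Rightarrow> complex) \<Rightarrow> ('a \<Rightarrow> complex)) \<Rightarrow> bool" where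
  "L2_bounded_operator \<mu> W \<longleftrightarrow>
     (\<forall>f \<in> L2_space \<mu>. W f \<in> L2_space \<mu>) \<and>
     (\<forall>f \<in> L2_space \<mu>. \<forall>g \<in> L2_space \<mu>.
        (AE x in \<mu>. f x = g x) \<longrightarrow> (AE x in \<mu>. W f x = W g x)) \<and>
     (\<forall>f \<in> L2_space \<mu>. \<forall>g \<in> L2_space \<mu>.
        AE x in \<mu>. W (\<lambda>y. f y + g y) x = W f x + W g x) \<and>
     (\<forall>a. \<forall>f \<in> L2_space \<mu>. AE x in \<mu>. W (\<lambda>y. a * f y) x = a * W f x) \<and>
     (\<exists>K. \<forall>f \<in> L2_space \<mu>. L2_norm \<mu> (W f) \<le> K * L2_norm \<mu> f)"

text \<open>As in \<^const>\<open>onorm\<close>, null vectors contribute \<open>0\<close> to the supremum since \<open>x / 0 = 0\<close>.\<close>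

definition L2_onorm :: "'a measure \<Rightarrow> (('a \<Rightarrow> complex) \<Rightarrow> ('a \<Rightarrow> complex)) \<Rightarrow> real" where
  "L2_onorm \<mu> A = (SUP f\<in>L2_space \<mu>. L2_norm \<mu> (A f) / L2_norm \<mu> f)"

definition proj :: "'a set \<Rightarrow> ('a \<Rightarrow> complex) \<Rightarrow> ('a \<Rightarrow> complex)" where
  "proj Y f = (\<lambda>x. indicator Y x * f x)"

definition is_partition :: "'a measure \<Rightarrow> nat \<Rightarrow> (nat \<Rightarrow> 'a set) \<Rightarrow> bool" where
  "is_partition \<mu> J Y \<longleftrightarrow>
     (\<forall>j\<in>{1..J}. Y j \<in> sets \<mu>) \<and>
     measure \<mu> (space \<mu> - (\<Union>j\<in>{1..J}. Y j)) = 0 \<and>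
     (\<forall>j\<in>{1..J}. \<forall>k\<in>{1..J}. j \<noteq> k \<longrightarrow> measure \<mu> (Y j \<inter> Y k) = 0)"

definition partition_sum ::
    "'a measure \<Rightarrow> (('a \<Rightarrow> complex) \<Rightarrow> ('a \<Rightarrow> complex)) \<Rightarrow> nat \<Rightarrow> (nat \<Rightarrow> 'a set) \<Rightarrow> real" where
  "partition_sum \<mu> W J Y = (\<Sum>j=1..J. measure \<mu> (Y j) * (L2_onorm \<mu> (W \<circ> proj (Y j)))\<^sup>2)"

definition mu_norm :: "'a measure \<Rightarrow> (('a \<Rightarrow> complex) \<Rightarrow> ('a \<Rightarrow> complex)) \<Rightarrow> real" where
  "mu_norm \<mu> W = (INF (J, Y) \<in> {(J, Y). is_partition \<mu> J Y}. sqrt (partition_sum \<mu> W J Y))"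

definition vartheta ::
    "'a::metric_space measure \<Rightarrow> (('a \<Rightarrow> complex) \<Rightarrow> ('a \<Rightarrow> complex)) \<Rightarrow> 'a \<Rightarrow> real" where
  "vartheta \<mu> W x = Lim (at_right 0) (\<lambda>\<epsilon>. (L2_onorm \<mu> (W \<circ> proj (ball x \<epsilon>)))\<^sup>2)"

end

theory Submission imports Defs begin

text \<open>
  Upper bound: cut a finite cover by balls on which \<open>\<parallel>W \<pi>\<^sub>B\<parallel>\<^sup>2\<close> is close to \<open>\<vartheta>\<close> at the
  centre into a partition. Lower bound: for every Borel set \<open>Y\<close>, \<open>\<vartheta> \<le> \<parallel>W \<pi>\<^sub>Y\<parallel>\<^sup>2\<close> almost
  everywhere on \<open>Y\<close>; integrating this over the cells of any partition gives the claim. Should it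
  fail on a subset of \<open>Y\<close> of positive measure, take a small ball in which that subset has positive
  measure and enclose this piece in an open \<open>U\<close> of small diameter with \<open>\<mu>(U - Y)\<close> negligible
  against \<open>\<mu>(U)\<close>. This use of outer regularity replaces Lebesgue density, which is not available
  in a general metric space. The test function \<open>f\<close> on \<open>U\<close> has nearly all its mass in \<open>Y\<close> because
  \<open>\<bar>f\<bar>\<close> is bounded above and below, so \<open>\<parallel>W f\<parallel>\<^sup>2\<close> is almost bounded by \<open>\<parallel>W \<pi>\<^sub>Y\<parallel>\<^sup>2 \<parallel>f\<parallel>\<^sup>2\<close>.
\<close>

section \<open>Square-integrable functions and their norm\<close>

lemma L2_norm_nonneg: "0 \<le> L2_norm \<mu> f"
  by (simp add: L2_norm_def)

lemma L2_norm_power2: "(L2_norm \<mu> f)\<^sup>2 = (\<integral>x. (cmod (f x))\<^sup>2 \<partial>\<mu>)"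
  by (simp add: L2_norm_def)

lemma L2_norm_cong_AE:
  assumes "f \<in> L2_space \<mu>" "g \<in> L2_space \<mu>" "AE x in \<mu>. f x = g x"
  shows "L2_norm \<mu> f = L2_norm \<mu> g"
proof -
  have "(\<integral>x. (cmod (f x))\<^sup>2 \<partial>\<mu>) = (\<integral>x. (cmod (g x))\<^sup>2 \<partial>\<mu>)"
    by (rule integral_cong_AE) (use assms in \<open>auto simp: L2_space_def\<close>)
  then show ?thesis by (simp add: L2_norm_def)
qed

lemma zero_in_L2_space: "(\<lambda>_. 0) \<in> L2_space \<mu>"
  by (simp add: L2_space_def)

lemma add_in_L2_space:
  assumes "f \<in> L2_space \<mu>" "g \<in> L2_space \<mu>"
  shows "(\<lambda>x. f x + g x) \<in> L2_space \<mu>"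
proof -
  have le: "(cmod (f x + g x))\<^sup>2 \<le> 2 * (cmod (f x))\<^sup>2 + 2 * (cmod (g x))\<^sup>2" for x
  proof -
    have "(cmod (f x + g x))\<^sup>2 \<le> (cmod (f x) + cmod (g x))\<^sup>2"
      by (simp add: norm_triangle_ineq power_mono)
    also have "\<dots> \<le> 2 * (cmod (f x))\<^sup>2 + 2 * (cmod (g x))\<^sup>2"
      using sum_squares_bound[of "cmod (f x)" "cmod (g x)"] by (simp add: power2_sum)
    finally show ?thesis .
  qed
  have [measurable]: "f \<in> borel_measurable \<mu>" "g \<in> borel_measurable \<mu>"
    and "integrable \<mu> (\<lambda>x. 2 * (cmod (f x))\<^sup>2 + 2 * (cmod (g x))\<^sup>2)"
    using assms by (simp_all add: L2_space_def)
  from this(3) have "integrable \<mu> (\<lambda>x. (cmod (f x + g x))\<^sup>2)"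
    by (rule Bochner_Integration.integrable_bound) (simp_all add: le)
  then show ?thesis by (simp add: L2_space_def)
qed

text \<open>Integrated form of the pointwise Young inequality
  \<open>2 a b \<le> t a^2 + b^2 / t\<close>. The weight \<open>t\<close> stays free so that, when
  the second summand is small, the coefficient of the first can be brought arbitrarily close to
  1.\<close>

lemma L2_norm_add_power2_le:
  assumes f: "f \<in> L2_space \<mu>" and g: "g \<in> L2_space \<mu>" and "t > 0"
  shows "(L2_norm \<mu> (\<lambda>x. f x + g x))\<^sup>2
    \<le> (1 + t) * (L2_norm \<mu> f)\<^sup>2 + (1 + 1 / t) * (L2_norm \<mu> g)\<^sup>2"
proof -
  have *: "(cmod (f x + g x))\<^sup>2 \<le> (1 + t) * (cmod (f x))\<^sup>2 + (1 + 1 / t) * (cmod (g x))\<^sup>2" for x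
  proof -
    have "(cmod (f x + g x))\<^sup>2 \<le> (cmod (f x) + cmod (g x))\<^sup>2"
      by (simp add: norm_triangle_ineq power_mono)
    moreover have "0 \<le> (t * cmod (f x) - cmod (g x))\<^sup>2 / t"
      using \<open>t > 0\<close> by simp
    moreover have "(t * cmod (f x) - cmod (g x))\<^sup>2 / t
        = t * (cmod (f x))\<^sup>2 - 2 * cmod (f x) * cmod (g x) + (cmod (g x))\<^sup>2 / t"
      using \<open>t > 0\<close> by (simp add: field_simps power2_eq_square)
    ultimately show ?thesis
      by (simp add: power2_sum algebra_simps)
  qed
  have int: "integrable \<mu> (\<lambda>x. (cmod (f x))\<^sup>2)" "integrable \<mu> (\<lambda>x. (cmod (g x))\<^sup>2)"
    using f g by (auto simp: L2_space_def)
  have "(\<integral>x. (cmod (f x + g x))\<^sup>2 \<partial>\<mu>)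
      \<le> (\<integral>x. (1 + t) * (cmod (f x))\<^sup>2 + (1 + 1 / t) * (cmod (g x))\<^sup>2 \<partial>\<mu>)"
    using int add_in_L2_space[OF f g]
    by (intro integral_mono * Bochner_Integration.integrable_add integrable_mult_right)
       (auto simp: L2_space_def)
  also have "\<dots> = (1 + t) * (\<integral>x. (cmod (f x))\<^sup>2 \<partial>\<mu>) + (1 + 1 / t) * (\<integral>x. (cmod (g x))\<^sup>2 \<partial>\<mu>)"
    using int by simp
  finally show ?thesis by (simp add: L2_norm_power2)
qed

section \<open>Projectors and operator norms\<close>

lemma proj_in_L2_space:
  assumes "f \<in> L2_space \<mu>" "Y \<in> sets \<mu>"
  shows "proj Y f \<in> L2_space \<mu>"
  using assms
  by (auto simp: L2_space_def proj_def norm_mult indicator_def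
      intro!: Bochner_Integration.integrable_bound[where f = "\<lambda>x. (cmod (f x))\<^sup>2"])

lemma L2_norm_proj_le:
  assumes "f \<in> L2_space \<mu>" "Y \<in> sets \<mu>"
  shows "L2_norm \<mu> (proj Y f) \<le> L2_norm \<mu> f"
proof -
  have "(\<integral>x. (cmod (proj Y f x))\<^sup>2 \<partial>\<mu>) \<le> (\<integral>x. (cmod (f x))\<^sup>2 \<partial>\<mu>)"
    using assms proj_in_L2_space[OF assms]
    by (intro integral_mono) (auto simp: L2_space_def proj_def indicator_def)
  then show ?thesis by (simp add: L2_norm_def)
qed

lemma proj_proj: "proj Y (proj Z f) = proj (Y \<inter> Z) f"
  by (auto simp: proj_def indicator_def)

text \<open>A supremum of reals is informative only over a set bounded above, so every use of
  \<open>L2_onorm\<close> rests on this. The sign of \<open>K\<close> is left open, hence the bound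
  \<open>\<bar>K\<bar>\<close>, which also covers the quotients of value 0 coming from null
  vectors.\<close>

lemma L2_onorm_bdd_above:
  assumes "\<And>f. f \<in> L2_space \<mu> \<Longrightarrow> L2_norm \<mu> (A f) \<le> K * L2_norm \<mu> f"
  shows "bdd_above ((\<lambda>f. L2_norm \<mu> (A f) / L2_norm \<mu> f) ` L2_space \<mu>)"
proof (rule bdd_aboveI2)
  fix g assume "g \<in> L2_space \<mu>"
  from assms[OF this] L2_norm_nonneg[of \<mu> g]
  show "L2_norm \<mu> (A g) / L2_norm \<mu> g \<le> \<bar>K\<bar>"
    by (cases "L2_norm \<mu> g = 0") (auto simp: pos_divide_le_eq intro: order_trans[OF _ mult_right_mono])
qed

lemma L2_norm_le_L2_onorm:
  assumes "\<And>f. f \<in> L2_space \<mu> \<Longrightarrow> L2_norm \<mu> (A f) \<le> K * L2_norm \<mu> f" and "f \<in> L2_space \<mu>"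
  shows "L2_norm \<mu> (A f) \<le> L2_onorm \<mu> A * L2_norm \<mu> f"
proof (cases "L2_norm \<mu> f = 0")
  case True
  \<comment> \<open>For a null vector the quotient says nothing about \<open>A f\<close>; the
    assumed bound itself forces the norm of \<open>A f\<close> to vanish.\<close>
  then show ?thesis using assms by force
next
  case False
  then have pos: "L2_norm \<mu> f > 0"
    using L2_norm_nonneg[of \<mu> f] by simp
  have "L2_norm \<mu> (A f) / L2_norm \<mu> f \<le> L2_onorm \<mu> A"
    unfolding L2_onorm_def by (rule cSUP_upper[OF assms(2) L2_onorm_bdd_above[OF assms(1)]])
  then show ?thesis using pos by (simp add: pos_divide_le_eq)
qed

lemma L2_onorm_le:
  assumes "\<And>f. f \<in> L2_space \<mu> \<Longrightarrow> L2_norm \<mu> (A f) \<le> B * L2_norm \<mu> f" and "0 \<le> B"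
  shows "L2_onorm \<mu> A \<le> B"
  unfolding L2_onorm_def
proof (rule cSUP_least)
  show "L2_space \<mu> \<noteq> {}" using zero_in_L2_space by blast
  fix g assume "g \<in> L2_space \<mu>"
  from assms(1)[OF this] assms(2) L2_norm_nonneg[of \<mu> g]
  show "L2_norm \<mu> (A g) / L2_norm \<mu> g \<le> B"
    by (cases "L2_norm \<mu> g = 0") (auto simp: pos_divide_le_eq)
qed

lemma L2_onorm_nonneg:
  assumes "\<And>f. f \<in> L2_space \<mu> \<Longrightarrow> L2_norm \<mu> (A f) \<le> K * L2_norm \<mu> f"
  shows "0 \<le> L2_onorm \<mu> A"
  using cSUP_upper[OF zero_in_L2_space L2_onorm_bdd_above[OF assms]]
  by (simp add: L2_onorm_def L2_norm_def)

text \<open>Projectors are contractions, so a single constant, made nonnegative by taking the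
  maximum with 0, serves for \<open>W\<close> and for all restrictions
  \<open>W \<circ> proj Y\<close> at once.\<close>

lemma L2_bounded_operator_proj_bound:
  assumes "L2_bounded_operator \<mu> W"
  obtains K where "0 \<le> K"
    and "\<And>f. f \<in> L2_space \<mu> \<Longrightarrow> L2_norm \<mu> (W f) \<le> K * L2_norm \<mu> f"
    and "\<And>Y f. Y \<in> sets \<mu> \<Longrightarrow> f \<in> L2_space \<mu> \<Longrightarrow> L2_norm \<mu> ((W \<circ> proj Y) f) \<le> K * L2_norm \<mu> f"
proof -
  obtain K0 where K0: "\<And>f. f \<in> L2_space \<mu> \<Longrightarrow> L2_norm \<mu> (W f) \<le> K0 * L2_norm \<mu> f"
    using assms unfolding L2_bounded_operator_def by metis
  define K where "K = max K0 0"
  have 1: "L2_norm \<mu> (W f) \<le> K * L2_norm \<mu> f" if "f \<in> L2_space \<mu>" for f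
    using K0[OF that] L2_norm_nonneg[of \<mu> f] mult_right_mono[of K0 K "L2_norm \<mu> f"]
    by (simp add: K_def)
  have 2: "L2_norm \<mu> ((W \<circ> proj Y) f) \<le> K * L2_norm \<mu> f"
    if "Y \<in> sets \<mu>" "f \<in> L2_space \<mu>" for Y f
    using 1[OF proj_in_L2_space[OF that(2,1)]]
      mult_left_mono[OF L2_norm_proj_le[OF that(2,1)], of K]
    by (simp add: K_def)
  show ?thesis by (rule that[OF _ 1 2]) (auto simp: K_def)
qed

lemma L2_norm_operator_proj_le:
  assumes "L2_bounded_operator \<mu> W" "Y \<in> sets \<mu>" "f \<in> L2_space \<mu>"
  shows "L2_norm \<mu> (W (proj Y f)) \<le> L2_onorm \<mu> (W \<circ> proj Y) * L2_norm \<mu> f"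
proof -
  obtain K where "\<And>f. f \<in> L2_space \<mu> \<Longrightarrow> L2_norm \<mu> ((W \<circ> proj Y) f) \<le> K * L2_norm \<mu> f"
    using L2_bounded_operator_proj_bound[OF assms(1)] assms(2) by metis
  from L2_norm_le_L2_onorm[OF this assms(3)] show ?thesis unfolding o_apply .
qed

lemma L2_onorm_proj_nonneg:
  assumes "L2_bounded_operator \<mu> W" "Y \<in> sets \<mu>"
  shows "0 \<le> L2_onorm \<mu> (W \<circ> proj Y)"
  using L2_bounded_operator_proj_bound[OF assms(1)] assms(2) L2_onorm_nonneg by metis

text \<open>A function cut off to \<open>Y\<close> is unchanged by a further cut-off to
  \<open>Z\<close>, and cutting off does not increase its norm. On balls this is the monotonicity in
  the radius that makes the limit in \<open>vartheta\<close> exist.\<close>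

lemma L2_onorm_proj_mono:
  assumes W: "L2_bounded_operator \<mu> W" and sets: "Y \<in> sets \<mu>" "Z \<in> sets \<mu>" and "Y \<subseteq> Z"
  shows "L2_onorm \<mu> (W \<circ> proj Y) \<le> L2_onorm \<mu> (W \<circ> proj Z)"
proof (rule L2_onorm_le)
  show nonneg: "0 \<le> L2_onorm \<mu> (W \<circ> proj Z)"
    by (rule L2_onorm_proj_nonneg[OF W sets(2)])
  fix f assume f: "f \<in> L2_space \<mu>"
  have "proj Y f = proj Z (proj Y f)"
    using \<open>Y \<subseteq> Z\<close> by (simp add: proj_proj Int_absorb1)
  then have "L2_norm \<mu> ((W \<circ> proj Y) f) = L2_norm \<mu> (W (proj Z (proj Y f)))"
    by simp
  also have "\<dots> \<le> L2_onorm \<mu> (W \<circ> proj Z) * L2_norm \<mu> (proj Y f)"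
    by (intro L2_norm_operator_proj_le W sets proj_in_L2_space f)
  also have "\<dots> \<le> L2_onorm \<mu> (W \<circ> proj Z) * L2_norm \<mu> f"
    by (intro mult_left_mono L2_norm_proj_le f sets nonneg)
  finally show "L2_norm \<mu> ((W \<circ> proj Y) f) \<le> L2_onorm \<mu> (W \<circ> proj Z) * L2_norm \<mu> f" .
qed

section \<open>Existence of the limit defining \<open>vartheta\<close>\<close>

lemma mono_tendsto_at_right_Inf:
  fixes g :: "real \<Rightarrow> real"
  assumes mono: "\<And>x y. a < x \<Longrightarrow> x \<le> y \<Longrightarrow> g x \<le> g y" and bdd: "bdd_below (g ` {a<..})"
  shows "(g \<longlongrightarrow> Inf (g ` {a<..})) (at_right a)"
proof (rule order_tendstoI)
  fix l assume "l < Inf (g ` {a<..})"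
  then have "l < g x" if "a < x" for x
    using cINF_lower[OF bdd, of x] that by auto
  then show "\<forall>\<^sub>F x in at_right a. l < g x"
    by (auto simp: eventually_at_right_field intro!: exI[of _ "a + 1"])
next
  fix u assume "Inf (g ` {a<..}) < u"
  then obtain b where "a < b" "g b < u"
    using bdd by (subst (asm) cInf_less_iff) auto
  then have "g x < u" if "a < x" "x < b" for x
    using mono[of x b] that by simp
  then show "\<forall>\<^sub>F x in at_right a. g x < u"
    using \<open>a < b\<close> by (auto simp: eventually_at_right_field)
qed

text \<open>\<open>Lim\<close> is a description operator and carries information only once
  convergence is known. Convergence holds because the squared norm on balls decreases with the
  radius and is bounded below by 0.\<close>

lemma vartheta_tendsto:
  fixes \<mu> :: "'a::metric_space measure"
  assumes sets: "sets \<mu> = sets borel" and W: "L2_bounded_operator \<mu> W"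
  shows "((\<lambda>\<epsilon>. (L2_onorm \<mu> (W \<circ> proj (ball x \<epsilon>)))\<^sup>2) \<longlongrightarrow> vartheta \<mu> W x) (at_right 0)"
proof -
  have [simp]: "ball x e \<in> sets \<mu>" for e
    by (simp add: sets)
  have "((\<lambda>\<epsilon>. (L2_onorm \<mu> (W \<circ> proj (ball x \<epsilon>)))\<^sup>2)
      \<longlongrightarrow> Inf ((\<lambda>\<epsilon>. (L2_onorm \<mu> (W \<circ> proj (ball x \<epsilon>)))\<^sup>2) ` {0<..})) (at_right 0)"
    by (rule mono_tendsto_at_right_Inf)
       (auto intro!: power_mono L2_onorm_proj_mono[OF W] L2_onorm_proj_nonneg[OF W] subset_ball
         bdd_belowI2[of _ 0])
  then show ?thesis
    unfolding vartheta_def by (simp add: tendsto_Lim)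
qed

section \<open>Regularity of finite Borel measures on metric spaces\<close>

text \<open>
  Outer regularity is proved together with inner regularity, since the pair of conditions is
  stable under complements.
\<close>

lemma borel_metric_closed_open_approx:
  fixes M :: "'a::metric_space measure"
  assumes "finite_measure M" and sets: "sets M = sets borel" and "B \<in> sets borel" and "0 < e"
  obtains F U where "closed F" "open U" "F \<subseteq> B" "B \<subseteq> U" "measure M (U - F) < e"
proof -
  interpret finite_measure M by fact
  have [measurable]: "A \<in> sets M" if "open A \<or> closed A" for A
    using that by (auto simp: sets)
  have "B \<in> sigma_sets UNIV {S. open S}"
    using assms(3) by (simp add: borel_def)
  then have "\<forall>e>0. \<exists>F U. closed F \<and> open U \<and> F \<subseteq> B \<and> B \<subseteq> U \<and> measure M (U - F) < e"
  proof (induction rule: sigma_sets.induct)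
    case (Basic G)
    then have "open G" by simp
    show ?case
    proof (intro allI impI)
      fix e :: real assume "0 < e"
      show "\<exists>F U. closed F \<and> open U \<and> F \<subseteq> G \<and> G \<subseteq> U \<and> measure M (U - F) < e"
      \<comment> \<open>The whole space is treated apart because \<open>infdist\<close> to the empty
        set is 0 by convention, which would make every \<open>F n\<close> below empty.\<close>
      proof (cases "G = UNIV")
        case True
        then show ?thesis using \<open>0 < e\<close> by (intro exI[of _ UNIV]) simp
      next
        case False
        define F where "F n = {x. 1 / real (Suc n) \<le> infdist x (- G)}" for n
        have cl: "closed (F n)" for n
          unfolding F_def by (intro closed_Collect_le continuous_intros)
        have pos: "x \<in> G \<longleftrightarrow> 0 < infdist x (- G)" for x
          using \<open>open G\<close> False in_closed_iff_infdist_zero[of "- G" x] infdist_nonneg[of x "- G"]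
          by (auto simp: closed_Compl less_le)
        have sub: "F n \<subseteq> G" for n
        proof
          fix x assume "x \<in> F n"
          then have "1 / real (Suc n) \<le> infdist x (- G)" by (simp add: F_def)
          moreover have "0 < 1 / real (Suc n)" by simp
          ultimately show "x \<in> G" unfolding pos by linarith
        qed
        have empty: "(\<Inter>n. G - F n) = {}"
        proof -
          have "\<exists>n. x \<in> F n" if "x \<in> G" for x
            using reals_Archimedean[of "infdist x (- G)"] that pos[of x]
            by (auto simp: F_def inverse_eq_divide intro: less_imp_le)
          then show ?thesis by blast
        qed
        have "decseq (\<lambda>n. G - F n)"
        proof (rule decseq_SucI)
          fix n
          have "1 / real (Suc (Suc n)) \<le> 1 / real (Suc n)" by (simp add: field_simps)
          then show "G - F (Suc n) \<subseteq> G - F n"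
            unfolding F_def by (auto intro: order_trans)
        qed
        moreover have "range (\<lambda>n. G - F n) \<subseteq> sets M"
          using cl \<open>open G\<close> by auto
        ultimately have "(\<lambda>n. measure M (G - F n)) \<longlonglongrightarrow> measure M (\<Inter>n. G - F n)"
          by (intro finite_Lim_measure_decseq)
        then have "(\<lambda>n. measure M (G - F n)) \<longlonglongrightarrow> 0"
          unfolding empty by simp
        then have "\<forall>\<^sub>F n in sequentially. measure M (G - F n) < e"
          using \<open>0 < e\<close> by (rule order_tendstoD)
        then obtain n where "measure M (G - F n) < e"
          by (auto simp: eventually_sequentially)
        then show ?thesis using cl sub \<open>open G\<close> by blast
      qed
    qed
  next
    case Empty
    have "measure M ({} - {}) < e" if "0 < e" for e using that by simp
    then show ?case using closed_empty open_empty by blast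
  next
    case (Compl A)
    show ?case
    proof (intro allI impI)
      fix e :: real assume "0 < e"
      then obtain F U where FU: "closed F" "open U" "F \<subseteq> A" "A \<subseteq> U" "measure M (U - F) < e"
        using Compl.IH by metis
      have "- F - - U = U - F" by blast
      then have "measure M (- F - - U) < e" using FU(5) by simp
      moreover have "closed (- U)" "open (- F)" "- U \<subseteq> UNIV - A" "UNIV - A \<subseteq> - F"
        using FU(1-4) by blast+
      ultimately show "\<exists>F U. closed F \<and> open U \<and> F \<subseteq> UNIV - A \<and> UNIV - A \<subseteq> U \<and> measure M (U - F) < e"
        by blast
    qed
  next
    case (Union A)
    show ?case
    proof (intro allI impI)
      fix e :: real assume "0 < e"
      \<comment> \<open>The tolerances add up to \<open>e / 2\<close>, strictly below
        \<open>e\<close>; the slack absorbs the later passage to finitely many of the closed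
        sets.\<close>
      define d where "d i = e / 2 * (1 / 2) ^ Suc i" for i :: nat
      have "0 < d i" for i using \<open>0 < e\<close> by (simp add: d_def)
      then have "\<forall>i. \<exists>F U. closed F \<and> open U \<and> F \<subseteq> A i \<and> A i \<subseteq> U \<and> measure M (U - F) < d i"
        using Union.IH by blast
      then obtain F U where FU: "\<And>i. closed (F i)" "\<And>i. open (U i)" "\<And>i. F i \<subseteq> A i"
        "\<And>i. A i \<subseteq> U i" "\<And>i. measure M (U i - F i) < d i"
        by metis
      let ?U = "\<Union>i. U i" and ?F = "\<lambda>n. \<Union>i\<le>n. F i"
      have [measurable]: "U i \<in> sets M" "F i \<in> sets M" for i
        using FU by auto
      have "d sums (e / 2)"
        unfolding d_def using sums_mult[OF power_half_series, of "e / 2"] by simp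
      then have d: "summable d" "suminf d = e / 2"
        by (auto simp: sums_iff)
      have summ: "summable (\<lambda>i. measure M (U i - F i))"
        by (rule summable_comparison_test'[OF d(1), of 0]) (use FU(5) in \<open>auto intro: less_imp_le\<close>)
      have "measure M (?U - (\<Union>i. F i)) \<le> measure M (\<Union>i. U i - F i)"
        by (rule finite_measure_mono) auto
      also have "\<dots> \<le> (\<Sum>i. measure M (U i - F i))"
        by (rule finite_measure_subadditive_countably[OF _ summ]) auto
      also have "\<dots> \<le> e / 2"
        unfolding d(2)[symmetric] using FU(5) by (intro suminf_le summ d(1)) (auto intro: less_imp_le)
      finally have le: "measure M (?U - (\<Union>i. F i)) < e"
        using \<open>0 < e\<close> by simp
      \<comment> \<open>An infinite union of closed sets need not be closed. Continuity from above
        of the finite measure lets a finite union \<open>?F n\<close> take its place with the gap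
        still below \<open>e\<close>.\<close>
      have eq: "(\<Inter>n. ?U - ?F n) = ?U - (\<Union>i. F i)" by auto
      have "decseq (\<lambda>n. ?U - ?F n)"
        by (rule decseq_SucI) (auto simp: atMost_Suc)
      then have "(\<lambda>n. measure M (?U - ?F n)) \<longlonglongrightarrow> measure M (\<Inter>n. ?U - ?F n)"
        by (intro finite_Lim_measure_decseq) auto
      then have "\<forall>\<^sub>F n in sequentially. measure M (?U - ?F n) < e"
        unfolding eq using le by (rule order_tendstoD)
      then obtain n where "measure M (?U - ?F n) < e"
        by (auto simp: eventually_sequentially)
      moreover have "closed (?F n)" using FU by (intro closed_UN) auto
      moreover have "open ?U" using FU by auto
      moreover have "?F n \<subseteq> (\<Union>i. A i)" "(\<Union>i. A i) \<subseteq> ?U" using FU(3,4) by blast+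
      ultimately show "\<exists>F U. closed F \<and> open U \<and> F \<subseteq> (\<Union>i. A i) \<and> (\<Union>i. A i) \<subseteq> U \<and> measure M (U - F) < e"
        by (intro exI[of _ "?F n"] exI[of _ ?U] conjI)
    qed
  qed
  then show ?thesis using that \<open>0 < e\<close> by blast
qed

section \<open>Partitions and finite covers\<close>

text \<open>Cells may overlap and may miss points, but only on null sets. Almost every point thus
  lies in exactly one cell, where the sum of indicators has a single nonzero term.\<close>

lemma integral_partition:
  fixes h :: "'a \<Rightarrow> real"
  assumes "finite_measure \<mu>" and P: "is_partition \<mu> J Y" and h: "integrable \<mu> h"
  shows "(\<integral>x. h x \<partial>\<mu>) = (\<Sum>j=1..J. \<integral>x. indicator (Y j) x * h x \<partial>\<mu>)"
proof -
  interpret finite_measure \<mu> by fact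
  have Y: "Y j \<in> sets \<mu>" if "j \<in> {1..J}" for j
    using P that by (simp add: is_partition_def)
  have null: "AE x in \<mu>. x \<notin> N" if "N \<in> sets \<mu>" "measure \<mu> N = 0" for N
    using that by (intro AE_not_in) (simp add: null_setsI emeasure_eq_measure)
  have 1: "AE x in \<mu>. x \<in> (\<Union>j\<in>{1..J}. Y j)"
    using null[of "space \<mu> - (\<Union>j\<in>{1..J}. Y j)"] P Y AE_space[of \<mu>]
    by (auto simp: is_partition_def)
  have "AE x in \<mu>. x \<notin> Y j \<inter> Y k" if "j \<in> {1..J}" "k \<in> {1..J}" "j \<noteq> k" for j k
    using P Y that by (intro null) (auto simp: is_partition_def)
  then have 2: "AE x in \<mu>. \<forall>j\<in>{1..J}. \<forall>k\<in>{1..J}. j \<noteq> k \<longrightarrow> x \<notin> Y j \<inter> Y k"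
    by (auto simp: AE_ball_countable AE_impI simp del: Int_iff)
  have "AE x in \<mu>. h x = (\<Sum>j=1..J. indicator (Y j) x * h x)"
    using 1 2
  proof eventually_elim
    case (elim x)
    then obtain j where j: "j \<in> {1..J}" "x \<in> Y j" by blast
    have "(\<Sum>k=1..J. indicator (Y k) x * h x) = (\<Sum>k=1..J. if k = j then h x else 0)"
      using elim(2) j by (intro sum.cong) (auto simp: indicator_def)
    then show ?case using j by simp
  qed
  then have "(\<integral>x. h x \<partial>\<mu>) = (\<integral>x. (\<Sum>j=1..J. indicator (Y j) x * h x) \<partial>\<mu>)"
    using h Y by (intro integral_cong_AE) (auto intro!: borel_measurable_sum borel_measurable_times)
  also have "\<dots> = (\<Sum>j=1..J. \<integral>x. indicator (Y j) x * h x \<partial>\<mu>)"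
    using h Y by (intro Bochner_Integration.integral_sum integrable_real_mult_indicator)
      (auto simp: mult.commute[of "indicator _ _"] intro!: integrable_real_mult_indicator)
  finally show ?thesis .
qed


text \<open>The radius may vary with the centre: the lower bound uses a constant radius, the upper
  bound one adapted to each point.\<close>

lemma compact_UNIV_finite_ball_cover:
  fixes r :: "'a::metric_space \<Rightarrow> real"
  assumes "compact (UNIV :: 'a set)" and r: "\<And>x. r x > 0"
  shows "\<exists>C. finite C \<and> (\<Union>x\<in>C. ball x (r x)) = UNIV"
proof -
  have "y \<in> (\<Union>x\<in>UNIV. ball x (r x))" for y
    by (rule UN_I[of y]) (simp_all add: r)
  then obtain C where "finite C" "UNIV \<subseteq> (\<Union>x\<in>C. ball x (r x))"
    by (auto intro: compactE_image[OF assms(1), of UNIV "\<lambda>x. ball x (r x)"])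
  then show ?thesis by (intro exI[of _ C] conjI top_le)
qed

section \<open>Lower bound: comparison on a single Borel set\<close>

lemma vartheta_le_L2_onorm_proj:
  fixes \<mu> :: "'a::metric_space measure"
  assumes cpt: "compact (UNIV :: 'a set)" and "finite_measure \<mu>"
    and sets: "sets \<mu> = sets borel" and W: "L2_bounded_operator \<mu> W"
    and meas: "vartheta \<mu> W \<in> borel_measurable \<mu>"
    and "c > 0" and \<gamma>: "(\<gamma> \<longlongrightarrow> 0) (at_right 0)"
    and test: "\<And>\<epsilon> U x. \<epsilon> > 0 \<Longrightarrow> open U \<Longrightarrow> diameter U \<le> \<epsilon> \<Longrightarrow> x \<in> U \<Longrightarrow> \<exists>f\<in>L2_space \<mu>.
           (AE y in \<mu>. f y = proj U f y) \<and>
           \<bar>(L2_norm \<mu> (W f))\<^sup>2 - vartheta \<mu> W x * (L2_norm \<mu> f)\<^sup>2\<bar> \<le> \<gamma> \<epsilon> * (L2_norm \<mu> f)\<^sup>2 \<and>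
           (AE y in \<mu>. y \<in> U \<longrightarrow> c < cmod (f y) \<and> cmod (f y) < inverse c)"
    and Y: "Y \<in> sets \<mu>"
  shows "AE x in \<mu>. x \<in> Y \<longrightarrow> vartheta \<mu> W x \<le> (L2_onorm \<mu> (W \<circ> proj Y))\<^sup>2"
proof -
  interpret finite_measure \<mu> by fact
  define a where "a = L2_onorm \<mu> (W \<circ> proj Y)"
  have "0 \<le> a" unfolding a_def by (rule L2_onorm_proj_nonneg[OF W Y])
  have space: "space \<mu> = UNIV"
    using sets_eq_imp_space_eq[OF sets] by simp
  obtain K where K: "0 \<le> K" "\<And>f. f \<in> L2_space \<mu> \<Longrightarrow> L2_norm \<mu> (W f) \<le> K * L2_norm \<mu> f"
    using L2_bounded_operator_proj_bound[OF W] by metis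
  \<comment> \<open>A fixed excess \<open>\<delta>\<close> leaves room for all error terms. The
    exceptional set is later exhausted by the countably many choices
    \<open>\<delta> = 1 / Suc n\<close>.\<close>
  have null: "measure \<mu> {x\<in>Y. a\<^sup>2 + \<delta> < vartheta \<mu> W x} = 0" if "\<delta> > 0" for \<delta>
  proof (rule ccontr)
    define A where "A = {x\<in>Y. a\<^sup>2 + \<delta> < vartheta \<mu> W x}"
    assume "measure \<mu> {x\<in>Y. a\<^sup>2 + \<delta> < vartheta \<mu> W x} \<noteq> 0"
    then have A_pos: "measure \<mu> A > 0"
      by (simp add: A_def zero_less_measure_iff)
    have A: "A \<in> sets \<mu>"
      proof -
      have "A = Y \<inter> {x\<in>space \<mu>. a\<^sup>2 + \<delta> < vartheta \<mu> W x}"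
        by (auto simp: A_def space)
      also have "\<dots> \<in> sets \<mu>" using meas by (intro sets.Int Y) measurable
      finally show ?thesis .
    qed
    have "\<forall>\<^sub>F e in at_right 0. \<gamma> e < \<delta> / 2"
      using \<gamma> that by (intro order_tendstoD(2)) auto
    then obtain b where "b > 0" and b: "\<And>e. 0 < e \<Longrightarrow> e < b \<Longrightarrow> \<gamma> e < \<delta> / 2"
      by (auto simp: eventually_at_right_field)
    define e where "e = b / 2"
    have e: "e > 0" "\<gamma> e < \<delta> / 2" using \<open>b > 0\<close> b[of e] by (auto simp: e_def)
    \<comment> \<open>Radius \<open>e / 2\<close> keeps every subset of a ball of the cover at
      diameter at most \<open>e\<close>, the scale at which the test functions have error below
      \<open>\<delta> / 2\<close>.\<close>
    obtain C :: "'a set" where C: "finite C" "(\<Union>x\<in>C. ball x (e / 2)) = UNIV"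
      using compact_UNIV_finite_ball_cover[of "\<lambda>_::'a. e / 2", OF cpt half_gt_zero[OF e(1)]] by auto
    have Ab: "A \<inter> ball x (e / 2) \<in> sets \<mu>" for x
      by (intro sets.Int A) (simp add: sets)
    have "\<exists>x\<in>C. measure \<mu> (A \<inter> ball x (e / 2)) > 0"
    proof (rule ccontr)
      assume "\<not> ?thesis"
      then have 0: "measure \<mu> (A \<inter> ball x (e / 2)) = 0" if "x \<in> C" for x
        using that by (simp add: zero_less_measure_iff)
      have "measure \<mu> A = measure \<mu> (\<Union>x\<in>C. A \<inter> ball x (e / 2))"
        unfolding Int_UN_distrib[symmetric] C(2) by simp
      also have "\<dots> \<le> (\<Sum>x\<in>C. measure \<mu> (A \<inter> ball x (e / 2)))"
        using Ab by (intro finite_measure_subadditive_finite C(1)) auto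
      also have "\<dots> = 0" using 0 by simp
      finally show False using A_pos by simp
    qed
    then obtain z where z: "measure \<mu> (A \<inter> ball z (e / 2)) > 0" by blast
    define D where "D = A \<inter> ball z (e / 2)"
    have D: "D \<in> sets \<mu>" "D \<subseteq> Y" using Ab by (simp_all add: D_def, auto simp: A_def)
    have "D \<noteq> {}" using z by (auto simp: D_def)
    then obtain x where x: "x \<in> D" by blast
    \<comment> \<open>The set \<open>D\<close> and the point \<open>x\<close> are fixed before
      \<open>t\<close> and \<open>\<eta>\<close>; only \<open>U\<close> and \<open>f\<close> depend
      on the latter. The right-hand side can therefore be made small afterwards while the left-hand
      side stays put.\<close>
    have key: "\<delta> / 2 \<le> t * a\<^sup>2 + (1 + 1 / t) * (K\<^sup>2 * \<eta>)" if "t > 0" "\<eta> > 0" for t \<eta>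
    proof -
      \<comment> \<open>The factor \<open>c ^ 4\<close> compensates for two estimates: the mass of
        \<open>f\<close> is at least \<open>c\<^sup>2\<close> times the measure of \<open>U\<close>,
        and its mass outside \<open>Y\<close> is at most \<open>(inverse c)\<^sup>2\<close> times
        the measure of \<open>U - Y\<close>.\<close>
      have "c ^ 4 * \<eta> * measure \<mu> D > 0" using \<open>c > 0\<close> that z by (simp add: D_def)
      from borel_metric_closed_open_approx[OF \<open>finite_measure \<mu>\<close> sets D(1)[unfolded sets] this]
      obtain F V where V: "open V" "D \<subseteq> V" "F \<subseteq> D" "closed F"
        "measure \<mu> (V - F) < c ^ 4 * \<eta> * measure \<mu> D" by metis
      \<comment> \<open>Intersecting with the ball keeps the diameter small and loses nothing of
        \<open>D\<close>. Since \<open>F \<subseteq> D \<subseteq> Y\<close>, the part of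
        \<open>U\<close> outside \<open>Y\<close> lies in \<open>V - F\<close>.\<close>
      define U where "U = V \<inter> ball z (e / 2)"
      have U: "open U" "D \<subseteq> U" using V by (auto simp: U_def D_def)
      have [measurable]: "U \<in> sets \<mu>" "V \<in> sets \<mu>" "F \<in> sets \<mu>" using U V by (simp_all add: sets)
      have "diameter U \<le> e"
      proof -
        have "dist p q \<le> e" if "p \<in> U" "q \<in> U" for p q
          using that dist_triangle_half_l[of p z e q] by (auto simp: U_def dist_commute intro: less_imp_le)
        then show ?thesis
          using e(1) unfolding diameter_def by (auto intro!: cSUP_least)
      qed
      have excess: "measure \<mu> (U - Y) \<le> c ^ 4 * \<eta> * measure \<mu> U"
      proof -
        have "measure \<mu> (U - Y) \<le> measure \<mu> (V - F)"
          using V(3) D(2) Y by (intro finite_measure_mono) (auto simp: U_def)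
        also have "\<dots> \<le> c ^ 4 * \<eta> * measure \<mu> D" using V by simp
        also have "\<dots> \<le> c ^ 4 * \<eta> * measure \<mu> U"
          using U \<open>c > 0\<close> \<open>\<eta> > 0\<close> by (intro mult_left_mono finite_measure_mono) auto
        finally show ?thesis .
      qed
      obtain f where f: "f \<in> L2_space \<mu>" "AE y in \<mu>. f y = proj U f y"
        "\<bar>(L2_norm \<mu> (W f))\<^sup>2 - vartheta \<mu> W x * (L2_norm \<mu> f)\<^sup>2\<bar> \<le> \<gamma> e * (L2_norm \<mu> f)\<^sup>2"
        "AE y in \<mu>. y \<in> U \<longrightarrow> c < cmod (f y) \<and> cmod (f y) < inverse c"
        using test[OF e(1) U(1) \<open>diameter U \<le> e\<close>] x U(2) by blast
      have int: "integrable \<mu> (\<lambda>y. (cmod (f y))\<^sup>2)" and [measurable]: "f \<in> borel_measurable \<mu>"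
        using f(1) by (auto simp: L2_space_def)
      define g where "g = proj Y f"
      define h where "h = proj (- Y) f"
      have Yc: "- Y \<in> sets \<mu>" using sets.compl_sets[OF Y] space by (simp add: Compl_eq_Diff_UNIV)
      have gh: "g \<in> L2_space \<mu>" "h \<in> L2_space \<mu>"
        using f(1) Y Yc by (auto simp: g_def h_def proj_in_L2_space)
      have f_lower: "c\<^sup>2 * measure \<mu> U \<le> (L2_norm \<mu> f)\<^sup>2"
      proof -
        have "c\<^sup>2 * measure \<mu> U = (\<integral>y. c\<^sup>2 * indicator U y \<partial>\<mu>)"
          using space by simp
        also have "\<dots> \<le> (\<integral>y. (cmod (f y))\<^sup>2 \<partial>\<mu>)"
        proof (rule integral_mono_AE[OF _ int])
          show "AE y in \<mu>. c\<^sup>2 * indicator U y \<le> (cmod (f y))\<^sup>2"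
            using f(4) by eventually_elim
              (use \<open>c > 0\<close> in \<open>auto simp: indicator_def intro: power_mono\<close>)
        qed (auto intro!: integrable_real_indicator simp: emeasure_eq_measure)
        finally show ?thesis by (simp add: L2_norm_power2)
      qed
      have h_upper: "(L2_norm \<mu> h)\<^sup>2 \<le> \<eta> * (L2_norm \<mu> f)\<^sup>2"
      proof -
        have "(L2_norm \<mu> h)\<^sup>2 \<le> (\<integral>y. (inverse c)\<^sup>2 * indicator (U - Y) y \<partial>\<mu>)"
          unfolding L2_norm_power2
        proof (rule integral_mono_AE)
          \<comment> \<open>Almost everywhere \<open>f\<close> vanishes off \<open>U\<close>, so
            \<open>h\<close> is supported in \<open>U - Y\<close>, where the upper bound on the
            modulus of \<open>f\<close> applies.\<close>
          show "AE y in \<mu>. (cmod (h y))\<^sup>2 \<le> (inverse c)\<^sup>2 * indicator (U - Y) y"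
            using f(2,4)
          proof eventually_elim
            case (elim y)
            show ?case
            proof (cases "y \<in> U - Y")
              case True
              then have "cmod (h y) \<le> inverse c" using elim by (simp add: h_def proj_def)
              then show ?thesis using True by (simp add: power_mono del: power_inverse)
            next
              case False
              then have "h y = 0" using elim by (auto simp: h_def proj_def)
              then show ?thesis by simp
            qed
          qed
          show "integrable \<mu> (\<lambda>y. (cmod (h y))\<^sup>2)" using gh(2) by (simp add: L2_space_def)
        qed (use Y in \<open>auto intro!: integrable_real_indicator simp: emeasure_eq_measure\<close>)
        also have "\<dots> = (inverse c)\<^sup>2 * measure \<mu> (U - Y)" using space by simp
        also have "\<dots> \<le> (inverse c)\<^sup>2 * (c ^ 4 * \<eta> * measure \<mu> U)"
          by (intro mult_left_mono excess) auto
        also have "\<dots> = \<eta> * (c\<^sup>2 * measure \<mu> U)"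
          using \<open>c > 0\<close> by (simp add: field_simps power2_eq_square power4_eq_xxxx)
        also have "\<dots> \<le> \<eta> * (L2_norm \<mu> f)\<^sup>2"
          using \<open>\<eta> > 0\<close> by (intro mult_left_mono f_lower) auto
        finally show ?thesis .
      qed
      have f_pos: "(L2_norm \<mu> f)\<^sup>2 > 0"
      proof -
        have "measure \<mu> D \<le> measure \<mu> U" using U by (intro finite_measure_mono) auto
        then have "0 < c\<^sup>2 * measure \<mu> U" using z \<open>c > 0\<close> by (simp add: D_def)
        then show ?thesis using f_lower by linarith
      qed
      have Wg: "(L2_norm \<mu> (W g))\<^sup>2 \<le> a\<^sup>2 * (L2_norm \<mu> f)\<^sup>2"
        using power_mono[OF L2_norm_operator_proj_le[OF W Y f(1)] L2_norm_nonneg, of 2]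
        by (simp add: a_def g_def power_mult_distrib)
      have "(L2_norm \<mu> (W h))\<^sup>2 \<le> K\<^sup>2 * (L2_norm \<mu> h)\<^sup>2"
        using power_mono[OF K(2)[OF gh(2)] L2_norm_nonneg, of 2] by (simp add: power_mult_distrib)
      also have "\<dots> \<le> K\<^sup>2 * (\<eta> * (L2_norm \<mu> f)\<^sup>2)"
        by (intro mult_left_mono h_upper) auto
      finally have Wh: "(L2_norm \<mu> (W h))\<^sup>2 \<le> K\<^sup>2 * \<eta> * (L2_norm \<mu> f)\<^sup>2" by (simp add: mult.assoc)
      have W_gh: "W g \<in> L2_space \<mu>" "W h \<in> L2_space \<mu>" "W f \<in> L2_space \<mu>"
        using W gh f(1) by (auto simp: L2_bounded_operator_def)
      have "f = (\<lambda>y. g y + h y)" by (auto simp: g_def h_def proj_def indicator_def)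
      then have "AE y in \<mu>. W f y = W g y + W h y"
        using W gh by (auto simp: L2_bounded_operator_def)
      then have "(L2_norm \<mu> (W f))\<^sup>2 = (L2_norm \<mu> (\<lambda>y. W g y + W h y))\<^sup>2"
        using L2_norm_cong_AE[OF W_gh(3) add_in_L2_space[OF W_gh(1,2)]] by simp
      also have "\<dots> \<le> (1 + t) * (L2_norm \<mu> (W g))\<^sup>2 + (1 + 1 / t) * (L2_norm \<mu> (W h))\<^sup>2"
        by (rule L2_norm_add_power2_le[OF W_gh(1,2) \<open>t > 0\<close>])
      also have "\<dots> \<le> (1 + t) * (a\<^sup>2 * (L2_norm \<mu> f)\<^sup>2) + (1 + 1 / t) * (K\<^sup>2 * \<eta> * (L2_norm \<mu> f)\<^sup>2)"
        using \<open>t > 0\<close> by (intro add_mono mult_left_mono Wg Wh) auto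
      finally have "(vartheta \<mu> W x - \<gamma> e) * (L2_norm \<mu> f)\<^sup>2
          \<le> ((1 + t) * a\<^sup>2 + (1 + 1 / t) * (K\<^sup>2 * \<eta>)) * (L2_norm \<mu> f)\<^sup>2"
        using f(3) by (simp add: algebra_simps)
      then have "vartheta \<mu> W x - \<gamma> e \<le> (1 + t) * a\<^sup>2 + (1 + 1 / t) * (K\<^sup>2 * \<eta>)"
        using f_pos by simp
      moreover have "a\<^sup>2 + \<delta> < vartheta \<mu> W x" using x by (simp add: D_def A_def)
      moreover have "(1 + t) * a\<^sup>2 = a\<^sup>2 + t * a\<^sup>2" by (simp add: algebra_simps)
      ultimately show ?thesis using e(2) by linarith
    qed
    \<comment> \<open>Both error terms become at most \<open>\<delta> / 8\<close>, and their sum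
      contradicts \<open>key\<close>. Adding 1 to \<open>a\<^sup>2\<close> and
      \<open>K\<^sup>2\<close> avoids division by zero; \<open>\<eta>\<close> is chosen after
      \<open>t\<close> to offset the large factor \<open>1 + 1 / t\<close>.\<close>
    define t where "t = \<delta> / 8 / (a\<^sup>2 + 1)"
    define \<eta> where "\<eta> = \<delta> / 8 / ((1 + 1 / t) * (K\<^sup>2 + 1))"
    have a1: "a\<^sup>2 + 1 > 0" and K1: "K\<^sup>2 + 1 > 0" by (auto intro: add_nonneg_pos)
    have "t > 0" using that a1 by (simp add: t_def)
    then have t1: "1 + 1 / t > 0" by (simp add: add_pos_pos)
    then have "\<eta> > 0" using that K1 by (simp add: \<eta>_def)
    have "t * a\<^sup>2 \<le> t * (a\<^sup>2 + 1)" using \<open>t > 0\<close> by simp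
    also have "\<dots> = \<delta> / 8"
      unfolding t_def using a1 by (intro nonzero_eq_divide_eq[THEN iffD1, OF _ refl]) simp
    finally have 1: "t * a\<^sup>2 \<le> \<delta> / 8" .
    have "(1 + 1 / t) * (K\<^sup>2 * \<eta>) \<le> (1 + 1 / t) * ((K\<^sup>2 + 1) * \<eta>)"
      using t1 \<open>\<eta> > 0\<close> by (intro mult_left_mono mult_right_mono) auto
    also have "\<dots> = \<delta> / 8"
      unfolding \<eta>_def mult.assoc[symmetric] using t1 K1
      by (subst mult.commute) (intro nonzero_eq_divide_eq[THEN iffD1, OF _ refl], simp)
    finally show False using key[OF \<open>t > 0\<close> \<open>\<eta> > 0\<close>] 1 that by linarith
  qed
  have "AE x in \<mu>. \<forall>n. x \<in> Y \<longrightarrow> vartheta \<mu> W x \<le> a\<^sup>2 + 1 / real (Suc n)"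
    unfolding AE_all_countable
  proof
    fix n
    let ?N = "{x\<in>Y. a\<^sup>2 + 1 / real (Suc n) < vartheta \<mu> W x}"
    have "?N = {x\<in>space \<mu>. x \<in> Y \<and> a\<^sup>2 + 1 / real (Suc n) < vartheta \<mu> W x}" using space by simp
    also have "\<dots> \<in> sets \<mu>" using Y meas by measurable
    finally have "?N \<in> null_sets \<mu>"
      using null[of "1 / real (Suc n)"] by (simp add: null_setsI emeasure_eq_measure)
    from AE_not_in[OF this]
    show "AE x in \<mu>. x \<in> Y \<longrightarrow> vartheta \<mu> W x \<le> a\<^sup>2 + 1 / real (Suc n)"
      by eventually_elim auto
  qed
  then show ?thesis
    unfolding a_def[symmetric]
  proof eventually_elim
    case (elim x)
    show ?case
    proof
      assume "x \<in> Y"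
      then have le: "vartheta \<mu> W x \<le> a\<^sup>2 + 1 / real (Suc n)" for n using elim by blast
      have "(\<lambda>n. a\<^sup>2 + 1 / real (Suc n)) \<longlonglongrightarrow> a\<^sup>2 + 0"
        by (intro tendsto_intros LIMSEQ_Suc[OF lim_1_over_n])
      from LIMSEQ_le_const[OF this] le show "vartheta \<mu> W x \<le> a\<^sup>2" by auto
    qed
  qed
qed

section \<open>Upper bound: a nearly optimal partition\<close>

text \<open>The error \<open>\<delta>\<close> is paid twice: once for replacing the norm on a ball
  by \<open>vartheta\<close> at the centre, once for replacing the centre by an arbitrary point of
  the ball. Total mass 1 keeps the integrated error at \<open>2 * \<delta>\<close>.\<close>

lemma exists_partition_sum_le:
  fixes \<mu> :: "'a::metric_space measure"
  assumes cpt: "compact (UNIV :: 'a set)" and prob: "prob_space \<mu>"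
    and sets: "sets \<mu> = sets borel" and W: "L2_bounded_operator \<mu> W"
    and cont: "continuous_on UNIV (vartheta \<mu> W)" and int: "integrable \<mu> (vartheta \<mu> W)"
    and "\<delta> > 0"
  obtains J Y where "is_partition \<mu> J Y"
    "partition_sum \<mu> W J Y \<le> (\<integral>x. vartheta \<mu> W x \<partial>\<mu>) + 2 * \<delta>"
proof -
  interpret prob_space \<mu> by fact
  have space: "space \<mu> = UNIV"
    using sets_eq_imp_space_eq[OF sets] by simp
  have "\<exists>r>0. (L2_onorm \<mu> (W \<circ> proj (ball x r)))\<^sup>2 < vartheta \<mu> W x + \<delta> \<and>
      (\<forall>y\<in>ball x r. vartheta \<mu> W x < vartheta \<mu> W y + \<delta>)" for x
  proof -
    have "\<forall>\<^sub>F r in at_right 0. (L2_onorm \<mu> (W \<circ> proj (ball x r)))\<^sup>2 < vartheta \<mu> W x + \<delta>"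
      using order_tendstoD(2)[OF vartheta_tendsto[OF sets W, of x]] \<open>\<delta> > 0\<close> by simp
    then obtain b where b: "b > 0"
      "\<And>r. 0 < r \<Longrightarrow> r < b \<Longrightarrow> (L2_onorm \<mu> (W \<circ> proj (ball x r)))\<^sup>2 < vartheta \<mu> W x + \<delta>"
      by (auto simp: eventually_at_right_field)
    obtain d where d: "d > 0" "\<And>y. dist y x < d \<Longrightarrow> dist (vartheta \<mu> W y) (vartheta \<mu> W x) < \<delta>"
      using cont \<open>\<delta> > 0\<close> unfolding continuous_on_iff by (metis UNIV_I)
    have "vartheta \<mu> W x < vartheta \<mu> W y + \<delta>" if "y \<in> ball x (min (b / 2) d)" for y
      using d(2)[of y] that by (auto simp: dist_commute dist_real_def)
    then show ?thesis
      \<comment> \<open>Halving \<open>b\<close> keeps the radius strictly below it, as the eventual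
        bound demands.\<close>
      using b d(1) by (intro exI[of _ "min (b / 2) d"]) auto
  qed
  then obtain r where r: "\<And>x. r x > 0"
    "\<And>x. (L2_onorm \<mu> (W \<circ> proj (ball x (r x))))\<^sup>2 < vartheta \<mu> W x + \<delta>"
    "\<And>x y. y \<in> ball x (r x) \<Longrightarrow> vartheta \<mu> W x < vartheta \<mu> W y + \<delta>"
    by metis
  obtain C where C: "finite C" "(\<Union>x\<in>C. ball x (r x)) = UNIV"
    using compact_UNIV_finite_ball_cover[of r, OF cpt r(1)] by auto
  obtain p where p: "bij_betw p {1..card C} C"
    using ex_bij_betw_nat_finite_1[OF C(1)] by blast
  define J where "J = card C"
  define B where "B j = ball (p j) (r (p j))" for j
  \<comment> \<open>Removing the earlier balls makes the cells genuinely disjoint. They still cover,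
    because each point lies in the cell of the first ball containing it.\<close>
  define Y where "Y j = B j - (\<Union>i\<in>{1..<j}. B i)" for j :: nat
  have cover: "(\<Union>j\<in>{1..J}. Y j) = UNIV"
  proof -
    have "\<exists>j\<in>{1..J}. y \<in> Y j" for y
    proof -
      obtain x where "x \<in> C" "y \<in> ball x (r x)" using UNIV_I[of y] unfolding C(2)[symmetric] by (rule UN_E)
      moreover obtain j where "j \<in> {1..J}" "p j = x"
        using bij_betw_imp_surj_on[OF p] \<open>x \<in> C\<close> unfolding J_def by (metis imageE)
      ultimately have "\<exists>j. j \<in> {1..J} \<and> y \<in> B j"
        by (auto simp: B_def)
      then obtain j where "j \<in> {1..J} \<and> y \<in> B j" "\<And>i. i < j \<Longrightarrow> \<not> (i \<in> {1..J} \<and> y \<in> B i)"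
        using exists_least_iff[of "\<lambda>j. j \<in> {1..J} \<and> y \<in> B j"] by blast
      then show ?thesis by (intro bexI[of _ j]) (auto simp: Y_def)
    qed
    then show ?thesis by blast
  qed
  have B: "B j \<in> sets \<mu>" for j by (simp add: B_def sets)
  then have Y: "Y j \<in> sets \<mu>" for j by (auto simp: Y_def)
  have disj: "Y j \<inter> Y k = {}" if "j \<in> {1..J}" "k \<in> {1..J}" "j \<noteq> k" for j k
    using that by (cases "j < k") (auto simp: Y_def)
  have P: "is_partition \<mu> J Y"
    using Y disj cover by (simp add: is_partition_def space)
  have "partition_sum \<mu> W J Y \<le> (\<Sum>j=1..J. \<integral>x. indicator (Y j) x * (vartheta \<mu> W x + 2 * \<delta>) \<partial>\<mu>)"
    unfolding partition_sum_def
  proof (rule sum_mono)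
    fix j
    let ?a = "(L2_onorm \<mu> (W \<circ> proj (Y j)))\<^sup>2"
    have "?a \<le> (L2_onorm \<mu> (W \<circ> proj (B j)))\<^sup>2"
      using Y B by (intro power_mono L2_onorm_proj_mono L2_onorm_proj_nonneg W) (auto simp: Y_def)
    also have "\<dots> < vartheta \<mu> W (p j) + \<delta>" unfolding B_def by (rule r)
    finally have a: "?a < vartheta \<mu> W (p j) + \<delta>" .
    have "?a \<le> vartheta \<mu> W y + 2 * \<delta>" if "y \<in> Y j" for y
      using a r(3)[of y "p j"] that by (simp add: Y_def B_def)
    then have "indicator (Y j) y * ?a \<le> indicator (Y j) y * (vartheta \<mu> W y + 2 * \<delta>)" for y
      by (simp add: indicator_def)
    moreover have "integrable \<mu> (\<lambda>y. indicator (Y j) y * (vartheta \<mu> W y + 2 * \<delta>))"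
      using integrable_real_mult_indicator[OF Y Bochner_Integration.integrable_add[OF int integrable_const]]
      by (simp add: mult.commute)
    ultimately have "(\<integral>y. indicator (Y j) y * ?a \<partial>\<mu>) \<le> (\<integral>y. indicator (Y j) y * (vartheta \<mu> W y + 2 * \<delta>) \<partial>\<mu>)"
      using Y by (intro integral_mono integrable_mult_left integrable_real_indicator)
        (auto simp: emeasure_eq_measure)
    then show "measure \<mu> (Y j) * ?a \<le> (\<integral>y. indicator (Y j) y * (vartheta \<mu> W y + 2 * \<delta>) \<partial>\<mu>)"
      by (simp add: space)
  qed
  also have "\<dots> = (\<integral>x. vartheta \<mu> W x + 2 * \<delta> \<partial>\<mu>)"
    by (rule integral_partition[symmetric, OF finite_measure_axioms P]) (simp add: int)
  also have "\<dots> = (\<integral>x. vartheta \<mu> W x \<partial>\<mu>) + 2 * \<delta>"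
    using int by (simp add: prob_space)
  finally show ?thesis using that P by blast
qed

section \<open>Passage to the infimum over partitions\<close>

theorem proposition5p2:
  fixes \<mu> :: "'a::metric_space measure"
    and W :: "('a \<Rightarrow> complex) \<Rightarrow> ('a \<Rightarrow> complex)"
  assumes "compact (UNIV :: 'a set)"
    and "prob_space \<mu>"
    and "sets \<mu> = sets borel"
    and "L2_bounded_operator \<mu> W"
    and C1: "continuous_on UNIV (vartheta \<mu> W)"
    and C2: "\<exists>c::real. c > 0 \<and> (\<exists>\<gamma>::real \<Rightarrow> real. (\<gamma> \<longlongrightarrow> 0) (at_right 0) \<and>
        (\<forall>\<epsilon>>0. \<forall>U::'a set. open U \<and> diameter U \<le> \<epsilon> \<longrightarrow> (\<forall>x\<in>U. \<exists>f\<in>L2_space \<mu>.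
           (AE y in \<mu>. f y = proj U f y) \<and>
           \<bar>(L2_norm \<mu> (W f))\<^sup>2 - vartheta \<mu> W x * (L2_norm \<mu> f)\<^sup>2\<bar> \<le> \<gamma> \<epsilon> * (L2_norm \<mu> f)\<^sup>2 \<and>
           (AE y in \<mu>. y \<in> U \<longrightarrow> c < cmod (f y) \<and> cmod (f y) < inverse c))))"
  shows "(mu_norm \<mu> W)\<^sup>2 = (\<integral>x. vartheta \<mu> W x \<partial>\<mu>)"
proof -
  interpret prob_space \<mu> by fact
  note cpt = assms(1) and sets = assms(3) and W = assms(4)
  let ?I = "\<integral>x. vartheta \<mu> W x \<partial>\<mu>"
  let ?P = "{(J, Y). is_partition \<mu> J Y}"
  have space: "space \<mu> = UNIV"
    using sets_eq_imp_space_eq[OF sets] by simp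
  have meas: "vartheta \<mu> W \<in> borel_measurable \<mu>"
    using borel_measurable_continuous_onI[OF C1] sets by (simp cong: measurable_cong_sets)
  \<comment> \<open>Continuity on a compact space gives boundedness, hence integrability for the
    probability measure.\<close>
  have "bounded (range (vartheta \<mu> W))"
    using compact_continuous_image[OF C1 cpt] compact_imp_bounded by blast
  then obtain b where "\<And>x. norm (vartheta \<mu> W x) \<le> b"
    by (auto simp: bounded_iff)
  then have int: "integrable \<mu> (vartheta \<mu> W)"
    by (intro integrable_const_bound[of _ b] meas) auto
  obtain c \<gamma> where c: "c > 0" "(\<gamma> \<longlongrightarrow> 0) (at_right 0)"
    and test: "\<And>\<epsilon> U x. \<epsilon> > 0 \<Longrightarrow> open U \<Longrightarrow> diameter U \<le> \<epsilon> \<Longrightarrow> x \<in> U \<Longrightarrow> \<exists>f\<in>L2_space \<mu>.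
           (AE y in \<mu>. f y = proj U f y) \<and>
           \<bar>(L2_norm \<mu> (W f))\<^sup>2 - vartheta \<mu> W x * (L2_norm \<mu> f)\<^sup>2\<bar> \<le> \<gamma> \<epsilon> * (L2_norm \<mu> f)\<^sup>2 \<and>
           (AE y in \<mu>. y \<in> U \<longrightarrow> c < cmod (f y) \<and> cmod (f y) < inverse c)"
    using C2 by auto
  have lower: "?I \<le> partition_sum \<mu> W J Y" if P: "is_partition \<mu> J Y" for J Y
  proof -
    have "?I = (\<Sum>j=1..J. \<integral>x. indicator (Y j) x * vartheta \<mu> W x \<partial>\<mu>)"
      by (rule integral_partition[OF finite_measure_axioms P int])
    also have "\<dots> \<le> partition_sum \<mu> W J Y"
      unfolding partition_sum_def
    proof (rule sum_mono)
      fix j assume "j \<in> {1..J}"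
      then have Y: "Y j \<in> sets \<mu>" using P by (simp add: is_partition_def)
      let ?a = "(L2_onorm \<mu> (W \<circ> proj (Y j)))\<^sup>2"
      have "AE x in \<mu>. indicator (Y j) x * vartheta \<mu> W x \<le> indicator (Y j) x * ?a"
        using vartheta_le_L2_onorm_proj[OF cpt finite_measure_axioms sets W meas c test Y]
        by (auto simp: indicator_def)
      moreover have "integrable \<mu> (\<lambda>x. indicator (Y j) x * vartheta \<mu> W x)"
        using integrable_real_mult_indicator[OF Y int] by (simp add: mult.commute)
      ultimately have "(\<integral>x. indicator (Y j) x * vartheta \<mu> W x \<partial>\<mu>) \<le> (\<integral>x. indicator (Y j) x * ?a \<partial>\<mu>)"
        using Y by (intro integral_mono_AE integrable_mult_left integrable_real_indicator)
          (auto simp: emeasure_eq_measure)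
      then show "(\<integral>x. indicator (Y j) x * vartheta \<mu> W x \<partial>\<mu>) \<le> measure \<mu> (Y j) * ?a"
        by (simp add: space)
    qed
    finally show ?thesis .
  qed
  have nonneg: "0 \<le> partition_sum \<mu> W J Y" for J Y
    unfolding partition_sum_def by (intro sum_nonneg) simp
  have bdd: "bdd_below ((\<lambda>(J, Y). sqrt (partition_sum \<mu> W J Y)) ` ?P)"
    by (rule bdd_belowI2[of _ 0]) (auto simp: nonneg)
  \<comment> \<open>The infimum is well behaved only over a nonempty set; the upper-bound
    construction with error parameter 1 already supplies a partition.\<close>
  have ne: "?P \<noteq> {}"
    by (rule exists_partition_sum_le[OF assms(1-4) C1 int zero_less_one]) auto
  have norm_nonneg: "0 \<le> mu_norm \<mu> W"
    unfolding mu_norm_def by (rule cINF_greatest[OF ne]) (auto simp: nonneg)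
  show ?thesis
  proof (rule antisym)
    show "(mu_norm \<mu> W)\<^sup>2 \<le> ?I"
    proof (rule field_le_epsilon)
      fix \<delta> :: real assume "\<delta> > 0"
      then obtain J Y where P: "is_partition \<mu> J Y" "partition_sum \<mu> W J Y \<le> ?I + 2 * (\<delta> / 2)"
        using exists_partition_sum_le[OF assms(1-4) C1 int, of "\<delta> / 2"] by auto
      have "mu_norm \<mu> W \<le> sqrt (partition_sum \<mu> W J Y)"
        unfolding mu_norm_def using cINF_lower[OF bdd, of "(J, Y)"] P(1) by simp
      then have "(mu_norm \<mu> W)\<^sup>2 \<le> (sqrt (partition_sum \<mu> W J Y))\<^sup>2"
        using norm_nonneg by (rule power_mono)
      then show "(mu_norm \<mu> W)\<^sup>2 \<le> ?I + \<delta>" using P(2) nonneg by simp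
    qed
  next
    \<comment> \<open>\<open>mu_norm\<close> is an infimum of square roots, so the bound valid for
      each partition is passed through \<open>sqrt\<close> first and squared only at the
      end.\<close>
    have "sqrt ?I \<le> mu_norm \<mu> W"
      unfolding mu_norm_def by (rule cINF_greatest[OF ne]) (auto intro: lower)
    then show "?I \<le> (mu_norm \<mu> W)\<^sup>2"
      by (rule sqrt_le_D)
  qed
qed

end
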